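(* Let $\Delta\ge 3$ and $n\ge\Delta+1$ be integers, and let $\ell=\max(0,\,2\Delta+1-n)$. Then the minimum of $\sigma(T)$ over all single-hub spiders $T$ on $n$ vertices with hub of degree $\Delta$ equals $$\ell\,(\Delta-1)^2+(\Delta-\ell)\big[(\Delta-2)^2+1\big].$$
   Context: For a tree $T$, $d(v)$ is the degree of $v$ and $\sigma(T)=\sum_{uv\in E(T)}(d(u)-d(v))^2$. A single-hub spider with hub of degree $\Delta$ is a tree consisting of one vertex $h$ (the hub) of degree $\Delta$ and $\Delta$ legs attached at $h$, where a leg is a path starting at $h$ whose interior vertices all have degree $2$ and which ends in a leaf; thus all vertices other than $h$ have degree $1$ or $2$. *)

theory Defs
  imports "Graph_Theory.Graph_Theory" "HOL-Library.Infinite_Typeclass"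
begin

text \<open>
  A finite simple graph is a \<^locale>\<open>pair_graph\<close>: a finite, loopfree, symmetric set of arcs, each
  undirected edge being represented by its two opposite arcs. Hence the degree of a vertex is its
  \<^const>\<open>out_degree\<close>.

  The predicate \<^const>\<open>tree\<close> of the digraph library is not usable here, because it counts the closed
  walk \<open>u, v, u\<close> along a single edge as a cycle. An undirected cycle is a library cycle of length
  at least 3.
\<close>

definition undirected_tree :: "'a pair_pre_digraph \<Rightarrow> bool" where
  "undirected_tree G \<longleftrightarrow> pair_graph G \<and> connected (with_proj G) \<and>
     \<not> (\<exists>p. pre_digraph.cycle (with_proj G) p \<and> 3 \<le> length p)"

abbreviation degree :: "'a pair_pre_digraph \<Rightarrow> 'a \<Rightarrow> nat" where
  "degree G v \<equiv> out_degree (with_proj G) v"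

text \<open>
  The sum ranges over arcs, so it counts every undirected edge exactly twice with the same
  (symmetric) summand; the division by 2 is therefore exact.
\<close>

definition sigma :: "'a pair_pre_digraph \<Rightarrow> int" where
  "sigma G = (\<Sum>(u, v)\<in>parcs G. (int (degree G u) - int (degree G v))\<^sup>2) div 2"

text \<open>A leg is given by its list of vertices, starting with the hub \<open>h\<close> and ending with the leaf.\<close>

definition leg :: "'a pair_pre_digraph \<Rightarrow> 'a \<Rightarrow> 'a list \<Rightarrow> bool" where
  "leg G h p \<longleftrightarrow> vpath p (with_proj G) \<and> 2 \<le> length p \<and> hd p = h \<and>
     (\<forall>v \<in> set (butlast (tl p)). degree G v = 2) \<and> degree G (last p) = 1"

definition single_hub_spider :: "'a pair_pre_digraph \<Rightarrow> 'a \<Rightarrow> nat \<Rightarrow> bool" where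
  "single_hub_spider G h \<Delta> \<longleftrightarrow> undirected_tree G \<and> h \<in> pverts G \<and> degree G h = \<Delta> \<and>
     (\<exists>L. finite L \<and> card L = \<Delta> \<and> (\<forall>p\<in>L. leg G h p) \<and>
        (\<forall>p\<in>L. \<forall>q\<in>L. p \<noteq> q \<longrightarrow> set p \<inter> set q = {h}) \<and>
        pverts G = insert h (\<Union>p\<in>L. set p) \<and>
        parcs G = (\<Union>p\<in>L. set (vwalk_arcs p) \<union> (set (vwalk_arcs p))\<inverse>))"

definition is_minimum :: "int \<Rightarrow> int set \<Rightarrow> bool" where
  "is_minimum m A \<longleftrightarrow> m \<in> A \<and> (\<forall>x\<in>A. m \<le> x)"

end

theory Submission
  imports Defs
begin

text \<open>
  Why the formula holds. In a spider with hub degree \<open>\<Delta>\<close>, a leg that is a single edge joins degrees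
  \<open>\<Delta>\<close> and \<open>1\<close> and contributes \<open>(\<Delta> - 1)\<^sup>2\<close>. On a longer leg only the first and the last edge join
  different degrees, namely \<open>\<Delta>, 2\<close> and \<open>2, 1\<close>, so it contributes \<open>(\<Delta> - 2)\<^sup>2 + 1\<close> whatever its length
  is. Hence \<open>\<sigma>\<close> depends only on the number \<open>k\<close> of one-edge legs (\<open>sigma_spider\<close>), and it grows by
  \<open>2 * (\<Delta> - 2) > 0\<close> with each of them: the minimum is attained when \<open>k\<close> is as small as possible.

  Each leg has at least two edges unless it is one of the \<open>k\<close> short ones, so the \<open>n - 1\<close> edges satisfy
  \<open>n - 1 \<ge> 2 * \<Delta> - k\<close>, that is, \<open>k \<ge> 2 * \<Delta> + 1 - n\<close> (\<open>card_pverts_ge\<close>). Conversely, legs of lengths one and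
  two, with any surplus of vertices put on one leg, reach this bound (\<open>hub_paths_with_fewest_short\<close>).

  Both halves work with the same object, a set of paths that start in \<open>h\<close> and meet nowhere else
  (locale \<open>hub_paths\<close>). The union of such paths is a single-hub spider
  (\<open>single_hub_spider_spider\<close>), and every single-hub spider arises in this way
  (\<open>single_hub_spider_eq_spider\<close>). For the first of these, acyclicity comes from orienting all edges
  away from the hub.
\<close>

section \<open>Acyclicity from an orientation\<close>

lemma pcas_consecutive:
  "pcas u p v \<Longrightarrow> Suc i < length p \<Longrightarrow> fst (p ! Suc i) = snd (p ! i)"
proof (induction p arbitrary: u i)
  case (Cons e es)
  then show ?case by (cases i; cases es) auto
qed simp

lemma pcas_ends:
  "pcas u p v \<Longrightarrow> p \<noteq> [] \<Longrightarrow> fst (hd p) = u \<and> snd (last p) = v"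
proof (induction p arbitrary: u)
  case (Cons e es)
  then show ?case by (cases "es = []") auto
qed simp

text \<open>
  Every vertex has at most one neighbour of smaller rank. On a cycle, both neighbours of a vertex of
  maximal rank have smaller rank, so they coincide, which the distinctness of the vertices allows
  only for cycles of length at most two.
\<close>
lemma no_long_cycle_if_oriented:
  fixes r :: "'a \<Rightarrow> nat"
  assumes arcs: "parcs G = E \<union> E\<inverse>"
    and increasing: "\<And>u v. (u, v) \<in> E \<Longrightarrow> r u < r v"
    and unique_parent: "\<And>u v w. (u, w) \<in> E \<Longrightarrow> (v, w) \<in> E \<Longrightarrow> u = v"
    and cycle: "pre_digraph.cycle (with_proj G) p"
  shows "length p < 3"
proof (rule ccontr)
  interpret pair_pre_digraph G .
  define k where "k = length p"
  assume "\<not> length p < 3"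
  hence k: "3 \<le> k" by (simp add: k_def)
  from cycle obtain u where u: "awalk u p u" "distinct (tl (pawalk_verts u p))" "p \<noteq> []"
    by (auto simp: cycle_def)
  have walk: "pcas u p u" and sub: "set p \<subseteq> parcs G" using u(1) by (auto simp: awalk_def)
  have dist: "distinct (map snd p)"
    using awalk_verts_conv'[OF walk] u(2,3) by simp
  have next_arc: "fst (p ! (Suc i mod k)) = snd (p ! i)" if "i < k" for i
  proof (cases "Suc i < k")
    case True
    then show ?thesis using pcas_consecutive[OF walk, of i] by (simp add: k_def)
  next
    case False
    hence i: "Suc i = k" using that by simp
    hence "i = length p - 1" by (simp add: k_def)
    hence "snd (p ! i) = u"
      using pcas_ends[OF walk u(3)] u(3) by (simp add: last_conv_nth)
    moreover have "fst (p ! 0) = u"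
      using pcas_ends[OF walk u(3)] u(3) by (simp add: hd_conv_nth)
    ultimately show ?thesis using i by simp
  qed
  have arc_cases: "p ! i \<in> E \<or> (snd (p ! i), fst (p ! i)) \<in> E" if "i < k" for i
  proof -
    have "p ! i \<in> E \<union> E\<inverse>" using that sub arcs nth_mem[of i p] unfolding k_def by blast
    thus ?thesis by (cases "p ! i") auto
  qed
  \<comment> \<open>The head of the arc at position \<open>i\<close> is a vertex of maximal rank on the cycle; the arcs at \<open>i\<close> and \<open>j\<close> enter and
    leave it, and the arc at \<open>i'\<close> precedes the one at \<open>i\<close>.\<close>
  obtain i where i: "i < k" and max: "\<And>j. j < k \<Longrightarrow> r (snd (p ! j)) \<le> r (snd (p ! i))"
  proof -
    let ?R = "(\<lambda>j. r (snd (p ! j))) ` {..<k}"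
    have "?R \<noteq> {}" using k by (auto simp: lessThan_empty_iff)
    hence "Max ?R \<in> ?R" by (intro Max_in) auto
    then obtain i where "i < k" "Max ?R = r (snd (p ! i))" by auto
    with that show ?thesis by (metis Max_ge finite_imageI finite_lessThan imageI lessThan_iff)
  qed
  define j where "j = Suc i mod k"
  define i' where "i' = (if i = 0 then k - 1 else i - 1)"
  have j: "j < k" and i': "i' < k" and suc_i': "Suc i' mod k = i" and neq: "i' \<noteq> j"
    using k i by (auto simp: j_def i'_def mod_Suc split: if_splits)
  have fst_i: "fst (p ! i) = snd (p ! i')" using next_arc[OF i'] suc_i' by simp
  have fst_j: "fst (p ! j) = snd (p ! i)" using next_arc[OF i] j_def by simp
  \<comment> \<open>An arc that is not in \<open>E\<close> descends in rank, so one of the two would show a vertex of higher rank.\<close>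
  have "(fst (p ! i), snd (p ! i)) \<in> E"
    using arc_cases[OF i] increasing max[OF i'] fst_i by (metis leD prod.collapse)
  moreover have "(snd (p ! j), snd (p ! i)) \<in> E"
    using arc_cases[OF j] increasing max[OF j] fst_j by (metis leD prod.collapse)
  ultimately have "snd (p ! i') = snd (p ! j)" using unique_parent fst_i by metis
  thus False using dist neq i' j by (auto simp: distinct_conv_nth k_def)
qed

section \<open>Systems of paths that meet only in their first vertex\<close>

lemma set_vwalk_arcs_conv_nth:
  "set (vwalk_arcs p) = {(p ! i, p ! Suc i) | i. Suc i < length p}"
proof (induction p rule: vwalk_arcs.induct)
  case (3 x y xs)
  have "{(((x # y # xs) ! i), (x # y # xs) ! Suc i) | i. Suc i < length (x # y # xs)}
      = insert (x, y) {((y # xs) ! i, (y # xs) ! Suc i) | i. Suc i < length (y # xs)}" (is "?A = ?B")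
  proof (intro equalityI subsetI)
    fix a assume "a \<in> ?A"
    then obtain i where "a = ((x # y # xs) ! i, (x # y # xs) ! Suc i)" "Suc i < length (x # y # xs)"
      by blast
    thus "a \<in> ?B" by (cases i) auto
  next
    fix a assume a: "a \<in> ?B"
    have "(x, y) \<in> ?A" by (auto intro!: exI[of _ 0])
    moreover have "((y # xs) ! i, (y # xs) ! Suc i) \<in> ?A" if "Suc i < length (y # xs)" for i
      using that by (auto intro!: exI[of _ "Suc i"])
    ultimately show "a \<in> ?A" using a by blast
  qed
  thus ?case using 3 by simp
qed auto

locale hub_paths =
  fixes L :: "'a list set" and h :: 'a
  assumes finite_paths: "finite L"
    and two_le_length: "p \<in> L \<Longrightarrow> 2 \<le> length p"
    and hd_path: "p \<in> L \<Longrightarrow> hd p = h"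
    and distinct_path: "p \<in> L \<Longrightarrow> distinct p"
    and meet_in_hub: "p \<in> L \<Longrightarrow> q \<in> L \<Longrightarrow> p \<noteq> q \<Longrightarrow> set p \<inter> set q = {h}"
begin

definition outward :: "'a rel" where
  "outward = (\<Union>p\<in>L. set (vwalk_arcs p))"

definition spider :: "'a pair_pre_digraph" where
  "spider = \<lparr>pverts = insert h (\<Union>p\<in>L. set p), parcs = outward \<union> outward\<inverse>\<rparr>"

lemma pverts_spider [simp]: "pverts spider = insert h (\<Union>p\<in>L. set p)"
  and parcs_spider [simp]: "parcs spider = outward \<union> outward\<inverse>"
  by (simp_all add: spider_def)

lemma nth_0: "p \<in> L \<Longrightarrow> p ! 0 = h"
  using two_le_length[of p] hd_path[of p] by (cases p) auto

text \<open>
  A vertex determines its distance from the hub and, unless it is the hub, the path on which it lies.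
  All structural facts about the spider below are read off from this.
\<close>
lemma same_vertex_position:
  assumes "p \<in> L" "q \<in> L" "i < length p" "j < length q" "p ! i = q ! j"
  shows "i = j" and "i = 0 \<or> p = q"
proof -
  have "i = j \<and> (i = 0 \<or> p = q)"
  proof (cases "p = q")
    case True
    then show ?thesis using assms distinct_path nth_eq_iff_index_eq by metis
  next
    case False
    have "p ! i \<in> set p \<inter> set q" using assms by (metis IntI nth_mem)
    hence "p ! i = h" using meet_in_hub[OF assms(1,2) False] by blast
    hence "p ! i = p ! 0" "q ! j = q ! 0" using nth_0 assms by auto
    moreover have "0 < length p" "0 < length q" using assms by auto
    ultimately have "i = 0" "j = 0"
      using distinct_path assms nth_eq_iff_index_eq by metis+
    thus ?thesis by simp
  qed
  thus "i = j" "i = 0 \<or> p = q" by blast+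
qed

lemma outward_iff:
  "(u, v) \<in> outward \<longleftrightarrow> (\<exists>p\<in>L. \<exists>i. Suc i < length p \<and> u = p ! i \<and> v = p ! Suc i)"
  by (auto simp: outward_def set_vwalk_arcs_conv_nth)

lemma outward_parent_unique:
  assumes "(u, w) \<in> outward" "(v, w) \<in> outward"
  shows "u = v"
proof -
  obtain p i q j where *: "p \<in> L" "Suc i < length p" "u = p ! i" "w = p ! Suc i"
    "q \<in> L" "Suc j < length q" "v = q ! j" "w = q ! Suc j"
    using assms by (auto simp: outward_iff)
  have "Suc i = Suc j" "Suc i = 0 \<or> p = q"
    using same_vertex_position[of p q "Suc i" "Suc j"] * by auto
  thus ?thesis using * by simp
qed

lemma distance_exists:
  obtains r :: "'a \<Rightarrow> nat" where "\<And>p i. p \<in> L \<Longrightarrow> i < length p \<Longrightarrow> r (p ! i) = i"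
proof
  let ?r = "\<lambda>v. THE i. \<exists>p\<in>L. i < length p \<and> p ! i = v"
  fix p i assume *: "p \<in> L" "i < length p"
  show "?r (p ! i) = i"
    by (rule the_equality) (use * same_vertex_position(1) in blast)+
qed

lemma outward_rank:
  obtains r :: "'a \<Rightarrow> nat" where "\<And>u v. (u, v) \<in> outward \<Longrightarrow> r u < r v"
proof -
  obtain r :: "'a \<Rightarrow> nat" where "\<And>p i. p \<in> L \<Longrightarrow> i < length p \<Longrightarrow> r (p ! i) = i"
    using distance_exists by blast
  hence "r u < r v" if "(u, v) \<in> outward" for u v
    using that by (auto simp: outward_iff)
  thus ?thesis by (rule that)
qed

lemma finite_outward: "finite outward"
  unfolding outward_def using finite_paths by auto

lemma outward_antisym: "outward \<inter> outward\<inverse> = {}"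
  using outward_rank by (metis converse_iff disjoint_iff order_less_asym surj_pair)

lemma pair_graph_spider: "pair_graph spider"
proof
  fix e assume e: "e \<in> parcs spider"
  obtain p where p: "p \<in> L" "e \<in> set (vwalk_arcs p) \<or> prod.swap e \<in> set (vwalk_arcs p)"
    using e by (cases e) (auto simp: outward_def)
  hence "e \<in> set p \<times> set p"
    using arcs_in_vwalk_arcs[of e p] arcs_in_vwalk_arcs[of "prod.swap e" p] by (cases e) auto
  thus "fst e \<in> pverts spider" "snd e \<in> pverts spider" using p(1) by auto
  show "fst e \<noteq> snd e"
    using e outward_antisym by (cases e) auto
next
  show "finite (pverts spider)" "finite (parcs spider)"
    using finite_paths finite_outward by auto
  show "symmetric spider" by (auto simp: symmetric_def sym_def)
qed

lemma connected_spider: "connected spider"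
proof -
  let ?R = "rtrancl_on (pverts spider) (parcs spider)"
  have sym: "sym ?R" by (intro rtrancl_on_sym) (auto simp: sym_def)
  have reach: "i < length p \<Longrightarrow> (h, p ! i) \<in> ?R" if p: "p \<in> L" for p i
  proof (induction i)
    case 0
    then show ?case by (simp add: nth_0[OF p])
  next
    case (Suc i)
    have "(p ! i, p ! Suc i) \<in> parcs spider" using Suc.prems p by (auto simp: outward_iff)
    moreover have "p ! Suc i \<in> pverts spider"
      using p nth_mem[OF Suc.prems] unfolding pverts_spider by blast
    ultimately show ?case using Suc by (auto intro: rtrancl_on_into_rtrancl_on)
  qed
  have hub: "(h, v) \<in> ?R" if v: "v \<in> pverts spider" for v
  proof (cases "v = h")
    case False
    then obtain p i where "p \<in> L" "i < length p" "v = p ! i"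
      using v by (auto simp: in_set_conv_nth)
    thus ?thesis using reach by blast
  qed simp
  have "(u, v) \<in> ?R" if "u \<in> pverts spider" "v \<in> pverts spider" for u v
    using hub that sym by (meson rtrancl_on_trans symE)
  moreover have "(parcs spider)\<^sup>s = parcs spider" by (auto simp: symcl_def)
  ultimately show ?thesis by (auto simp: connected_conv simp del: parcs_spider)
qed

lemma undirected_tree_spider: "undirected_tree spider"
proof -
  obtain r :: "'a \<Rightarrow> nat" where r: "\<And>u v. (u, v) \<in> outward \<Longrightarrow> r u < r v"
    using outward_rank by blast
  have "length p < 3" if "pre_digraph.cycle spider p" for p
    by (rule no_long_cycle_if_oriented[OF parcs_spider r outward_parent_unique that])
  thus ?thesis
    using pair_graph_spider connected_spider unfolding undirected_tree_def by (meson not_less)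
qed

section \<open>Degrees in the spider\<close>

lemma degree_conv_neighbours:
  "degree spider v = card {w. (v, w) \<in> outward \<or> (w, v) \<in> outward}"
proof -
  have "out_arcs spider v = Pair v ` {w. (v, w) \<in> outward \<or> (w, v) \<in> outward}"
    by auto
  thus ?thesis by (simp add: out_degree_def card_image inj_on_def)
qed

lemma degree_hub: "degree spider h = card L"
proof -
  have "{w. (h, w) \<in> outward \<or> (w, h) \<in> outward} = (\<lambda>p. p ! 1) ` L" (is "?N = _")
  proof (intro equalityI subsetI)
    fix w assume "w \<in> ?N"
    then obtain p i where p: "p \<in> L" "Suc i < length p"
      and or: "h = p ! i \<and> w = p ! Suc i \<or> w = p ! i \<and> h = p ! Suc i"
      by (auto simp: outward_iff)
    have "j = 0" if "h = p ! j" "j < length p" for j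
    proof -
      have "p ! j = p ! 0" using that nth_0[OF p(1)] by simp
      thus ?thesis using same_vertex_position(1)[OF p(1,1), of j 0] that p(2) by fastforce
    qed
    hence "w = p ! 1" using or p by fastforce
    thus "w \<in> (\<lambda>p. p ! 1) ` L" using p by blast
  next
    fix w assume "w \<in> (\<lambda>p. p ! 1) ` L"
    then obtain p where "p \<in> L" "w = p ! 1" by blast
    moreover have "Suc 0 < length p" using two_le_length[of p] calculation by simp
    ultimately show "w \<in> ?N" using nth_0 by (fastforce simp: outward_iff)
  qed
  moreover have "inj_on (\<lambda>p. p ! 1) L"
  proof (rule inj_onI)
    fix p q assume "p \<in> L" "q \<in> L" "p ! 1 = q ! 1"
    thus "p = q" using same_vertex_position(2)[of p q 1 1] two_le_length by fastforce
  qed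
  ultimately show ?thesis by (simp add: degree_conv_neighbours card_image)
qed

text \<open>
  A vertex other than the hub lies on one path only, so its neighbours are its predecessor and, if it
  is not the end of the path, its successor there.
\<close>
lemma neighbours_of_nth:
  assumes p: "p \<in> L" and i: "0 < i" "i < length p"
  shows "{w. (p ! i, w) \<in> outward \<or> (w, p ! i) \<in> outward}
    = insert (p ! (i - 1)) (if Suc i < length p then {p ! Suc i} else {})" (is "?N = ?M")
proof (intro equalityI subsetI)
  fix w assume "w \<in> ?N"
  then consider q j where "q \<in> L" "Suc j < length q" "p ! i = q ! j" "w = q ! Suc j"
    | q j where "q \<in> L" "Suc j < length q" "w = q ! j" "p ! i = q ! Suc j"
    by (auto simp: outward_iff)
  thus "w \<in> ?M"
  proof cases
    case 1
    hence "i = j" "p = q" using same_vertex_position[of p q i j] p i by auto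
    thus ?thesis using 1 by simp
  next
    case 2
    hence "i = Suc j" "p = q" using same_vertex_position[of p q i "Suc j"] p i by auto
    thus ?thesis using 2 by simp
  qed
next
  fix w assume w: "w \<in> ?M"
  have "(p ! (i - 1), p ! i) \<in> outward" using p i by (auto simp: outward_iff intro!: bexI[of _ p] exI[of _ "i - 1"])
  moreover have "(p ! i, p ! Suc i) \<in> outward" if "Suc i < length p"
    using p that by (auto simp: outward_iff)
  ultimately show "w \<in> ?N" using w by (auto split: if_splits)
qed

lemma degree_nth:
  assumes p: "p \<in> L" and i: "0 < i" "i < length p"
  shows "degree spider (p ! i) = (if Suc i < length p then 2 else 1)"
proof -
  have "p ! (i - 1) \<noteq> p ! Suc i" if "Suc i < length p"
  proof
    assume "p ! (i - 1) = p ! Suc i"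
    hence "i - 1 = Suc i"
      using i that by (intro same_vertex_position(1)[OF p p]) auto
    thus False by simp
  qed
  thus ?thesis unfolding degree_conv_neighbours neighbours_of_nth[OF assms] by simp
qed

lemma leg_spider:
  assumes p: "p \<in> L"
  shows "leg spider h p"
proof -
  have len: "2 \<le> length p" using p by (rule two_le_length)
  have "vpath p spider"
  proof
    show "vwalk p spider" using p len by (intro vwalkI) (auto simp: outward_def)
    show "distinct p" using p by (rule distinct_path)
  qed
  moreover have "degree spider v = 2" if v: "v \<in> set (butlast (tl p))" for v
  proof -
    obtain i where i: "i < length p - 2" "v = butlast (tl p) ! i"
      using v by (fastforce simp: in_set_conv_nth numeral_2_eq_2)
    hence "v = p ! Suc i" by (simp add: nth_butlast nth_tl)
    thus ?thesis using degree_nth[OF p, of "Suc i"] i by simp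
  qed
  moreover have "degree spider (last p) = 1"
    using degree_nth[OF p, of "length p - 1"] len by (subst last_conv_nth) auto
  ultimately show ?thesis using len hd_path[OF p] by (auto simp: leg_def)
qed

lemma single_hub_spider_spider: "single_hub_spider spider h (card L)"
  unfolding single_hub_spider_def
proof (intro conjI exI[of _ L])
  show "parcs spider = (\<Union>p\<in>L. set (vwalk_arcs p) \<union> (set (vwalk_arcs p))\<inverse>)"
    by (auto simp: outward_def)
  show "\<forall>p\<in>L. \<forall>q\<in>L. p \<noteq> q \<longrightarrow> set p \<inter> set q = {h}"
    by (intro ballI impI meet_in_hub)
  show "\<forall>p\<in>L. leg spider h p" by (intro ballI leg_spider)
  show "undirected_tree spider" by (rule undirected_tree_spider)
  show "h \<in> pverts spider" by simp
  show "degree spider h = card L" by (rule degree_hub)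
  show "finite L" by (rule finite_paths)
  show "card L = card L" by (rule refl)
  show "pverts spider = insert h (\<Union>p\<in>L. set p)" by simp
qed

section \<open>Order and irregularity of the spider\<close>

lemma card_pverts: "card (pverts spider) = Suc (\<Sum>p\<in>L. length p - 1)"
proof -
  have split: "set p = insert h (set (tl p)) \<and> h \<notin> set (tl p) \<and> distinct (tl p)" if "p \<in> L" for p
    using that two_le_length[OF that] hd_path[OF that] distinct_path[OF that] by (cases p) auto
  have "pverts spider = insert h (\<Union>p\<in>L. set (tl p))"
  proof -
    have "x \<in> set p \<longleftrightarrow> x = h \<or> x \<in> set (tl p)" if "p \<in> L" for p x
      using split[OF that] by blast
    thus ?thesis unfolding pverts_spider by blast
  qed
  moreover have "h \<notin> (\<Union>p\<in>L. set (tl p))" using split by blast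
  moreover have "card (\<Union>p\<in>L. set (tl p)) = (\<Sum>p\<in>L. card (set (tl p)))"
  proof (rule card_UN_disjoint)
    show "\<forall>p\<in>L. \<forall>q\<in>L. p \<noteq> q \<longrightarrow> set (tl p) \<inter> set (tl q) = {}"
    proof (intro ballI impI)
      fix p q assume "p \<in> L" "q \<in> L" "p \<noteq> q"
      hence "set p \<inter> set q = {h}" by (rule meet_in_hub)
      thus "set (tl p) \<inter> set (tl q) = {}"
        using split[OF \<open>p \<in> L\<close>] split[OF \<open>q \<in> L\<close>] by auto
    qed
  qed (use finite_paths in auto)
  moreover have "(\<Sum>p\<in>L. card (set (tl p))) = (\<Sum>p\<in>L. length p - 1)"
    using split by (intro sum.cong refl) (metis distinct_card length_tl)
  ultimately show ?thesis using finite_paths by simp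
qed

text \<open>
  The factor 2, which the definition of \<^const>\<open>sigma\<close> divides out again, appears because each edge is
  present in both orientations.
\<close>
lemma sum_arcs_spider:
  fixes f :: "'a \<times> 'a \<Rightarrow> 'b :: comm_semiring_1"
  assumes sym: "\<And>u v. f (u, v) = f (v, u)"
  shows "sum f (parcs spider) = 2 * (\<Sum>p\<in>L. \<Sum>i<length p - 1. f (p ! i, p ! Suc i))"
proof -
  have "sum f (parcs spider) = sum f outward + sum f (outward\<inverse>)"
    using finite_outward outward_antisym by (simp add: sum.union_disjoint)
  also have "sum f (outward\<inverse>) = sum f outward"
    by (rule sum.reindex_bij_witness[of _ prod.swap prod.swap]) (auto simp: sym)
  also have "sum f outward = (\<Sum>p\<in>L. sum f (set (vwalk_arcs p)))"
    unfolding outward_def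
  proof (rule sum.UNION_disjoint)
    show "\<forall>p\<in>L. \<forall>q\<in>L. p \<noteq> q \<longrightarrow> set (vwalk_arcs p) \<inter> set (vwalk_arcs q) = {}"
    proof (intro ballI impI equals0I)
      fix p q a assume *: "p \<in> L" "q \<in> L" "p \<noteq> q" "a \<in> set (vwalk_arcs p) \<inter> set (vwalk_arcs q)"
      then obtain i j where "Suc i < length p" "Suc j < length q" "p ! Suc i = q ! Suc j"
        by (auto simp: set_vwalk_arcs_conv_nth)
      thus False using same_vertex_position(2)[of p q "Suc i" "Suc j"] * by auto
    qed
  qed (use finite_paths in auto)
  also have "\<dots> = (\<Sum>p\<in>L. \<Sum>i<length p - 1. f (p ! i, p ! Suc i))"
  proof (rule sum.cong[OF refl])
    fix p assume p: "p \<in> L"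
    have "set (vwalk_arcs p) = (\<lambda>i. (p ! i, p ! Suc i)) ` {..<length p - 1}"
      by (auto simp: set_vwalk_arcs_conv_nth)
    moreover have "inj_on (\<lambda>i. (p ! i, p ! Suc i)) {..<length p - 1}"
      using same_vertex_position(1)[OF p p] by (auto simp: inj_on_def)
    ultimately show "sum f (set (vwalk_arcs p)) = (\<Sum>i<length p - 1. f (p ! i, p ! Suc i))"
      by (simp add: sum.reindex)
  qed
  finally show ?thesis by (simp add: mult_2)
qed

text \<open>
  The degrees along a path are \<open>card L, 2, \<dots>, 2, 1\<close>, so behind the first edge only the last one has a
  nonzero summand. A path of two vertices is a single edge, from degree \<open>card L\<close> to degree 1.
\<close>
lemma path_contribution:
  assumes p: "p \<in> L"
  shows "(\<Sum>i<length p - 1. (int (degree spider (p ! i)) - int (degree spider (p ! Suc i)))\<^sup>2)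
    = (if length p = 2 then (int (card L) - 1)\<^sup>2 else (int (card L) - 2)\<^sup>2 + 1)" (is "?S = _")
proof -
  obtain m where m: "length p = Suc (Suc m)"
    using two_le_length[OF p] by (metis add_2_eq_Suc le_Suc_ex)
  have deg: "degree spider (p ! Suc i) = (if i < m then 2 else 1)" if "i \<le> m" for i
    using degree_nth[OF p, of "Suc i"] that m by simp
  have "?S = (int (card L) - int (degree spider (p ! 1)))\<^sup>2
      + (\<Sum>i<m. (int (degree spider (p ! Suc i)) - int (degree spider (p ! Suc (Suc i))))\<^sup>2)"
    using m by (simp add: sum.lessThan_Suc_shift nth_0[OF p] degree_hub del: sum.lessThan_Suc)
  also have "(\<Sum>i<m. (int (degree spider (p ! Suc i)) - int (degree spider (p ! Suc (Suc i))))\<^sup>2)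
      = (\<Sum>i<m. if Suc i = m then 1 else 0)"
    by (intro sum.cong) (auto simp: deg)
  also have "\<dots> = (if m = 0 then 0 else 1)"
    by (cases m) auto
  finally show ?thesis using deg[of 0] m by (cases m) auto
qed

lemma sigma_spider:
  fixes \<Delta> :: int
  defines "\<Delta> \<equiv> int (card L)" and "k \<equiv> int (card {p \<in> L. length p = 2})"
  shows "sigma spider = k * (\<Delta> - 1)\<^sup>2 + (\<Delta> - k) * ((\<Delta> - 2)\<^sup>2 + 1)"
proof -
  let ?d = "\<lambda>v. int (degree spider v)"
  have "sigma spider = (\<Sum>p\<in>L. \<Sum>i<length p - 1. (?d (p ! i) - ?d (p ! Suc i))\<^sup>2)"
    unfolding sigma_def by (subst sum_arcs_spider) (simp_all add: power2_commute)
  also have "\<dots> = (\<Sum>p\<in>L. if length p = 2 then (\<Delta> - 1)\<^sup>2 else (\<Delta> - 2)\<^sup>2 + 1)"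
    unfolding \<Delta>_def by (intro sum.cong refl path_contribution)
  also have "\<dots> = k * (\<Delta> - 1)\<^sup>2 + int (card {p \<in> L. length p \<noteq> 2}) * ((\<Delta> - 2)\<^sup>2 + 1)"
    using finite_paths by (simp add: sum.If_cases k_def Int_def Collect_neg_eq[symmetric])
  also have "int (card {p \<in> L. length p \<noteq> 2}) = \<Delta> - k"
  proof -
    have "card L = card {p \<in> L. length p = 2} + card {p \<in> L. length p \<noteq> 2}"
      using finite_paths by (subst card_Un_disjoint[symmetric]) (auto intro: arg_cong[of _ _ card])
    thus ?thesis by (simp add: \<Delta>_def k_def)
  qed
  finally show ?thesis .
qed

text \<open>
  Crediting every two-vertex path with one additional vertex gives each path at least two vertices
  apart from the hub.
\<close>
lemma card_pverts_ge: "2 * card L + 1 \<le> card (pverts spider) + card {p \<in> L. length p = 2}"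
proof -
  have "2 * card L = (\<Sum>p\<in>L. 2)" by simp
  also have "\<dots> \<le> (\<Sum>p\<in>L. (length p - 1) + (if length p = 2 then 1 else 0))"
  proof (rule sum_mono)
    fix p assume "p \<in> L"
    thus "2 \<le> length p - 1 + (if length p = 2 then 1 else 0)"
      using two_le_length[of p] by auto
  qed
  also have "\<dots> = (\<Sum>p\<in>L. length p - 1) + card {p \<in> L. length p = 2}"
    using finite_paths by (simp add: sum.distrib sum.If_cases Int_def)
  finally show ?thesis using card_pverts by simp
qed

end

section \<open>Spiders as unions of paths\<close>

lemma single_hub_spider_eq_spider:
  assumes "single_hub_spider T h \<Delta>"
  obtains L where "hub_paths L h" "card L = \<Delta>" "T = hub_paths.spider L h"
proof -
  obtain L where L: "finite L" "card L = \<Delta>" "\<forall>p\<in>L. leg T h p"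
      "\<forall>p\<in>L. \<forall>q\<in>L. p \<noteq> q \<longrightarrow> set p \<inter> set q = {h}"
      "pverts T = insert h (\<Union>p\<in>L. set p)"
      "parcs T = (\<Union>p\<in>L. set (vwalk_arcs p) \<union> (set (vwalk_arcs p))\<inverse>)"
    using assms unfolding single_hub_spider_def by blast
  interpret hub_paths L h
    by unfold_locales (use L in \<open>auto simp: leg_def\<close>)
  have "T = spider"
    using L by (intro pair_pre_digraph.equality) (auto simp: outward_def)
  with L that hub_paths_axioms show ?thesis by blast
qed

text \<open>
  An injection of \<open>\<nat> \<times> \<nat>\<close> into the vertex type provides fresh vertices: the \<open>i\<close>-th path runs along the
  \<open>i\<close>-th row. The last conclusion states that the lengths of the paths, counted with multiplicity, are
  the numbers \<open>m i + 1\<close>.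
\<close>
lemma hub_paths_with_lengths:
  fixes m :: "nat \<Rightarrow> nat"
  assumes m: "\<And>i. i < \<Delta> \<Longrightarrow> 1 \<le> m i"
  obtains L and h :: "'a :: infinite" where "hub_paths L h" "card L = \<Delta>"
    "\<forall>g :: nat \<Rightarrow> nat. (\<Sum>p\<in>L. g (length p)) = (\<Sum>i<\<Delta>. g (Suc (m i)))"
proof -
  obtain f :: "nat \<Rightarrow> 'a" where f: "inj f"
    using infinite_countable_subset[OF infinite_UNIV] by blast
  define w where "w i j = f (prod_encode (i, j))" for i j
  have w_eq: "w i j = w i' j' \<longleftrightarrow> i = i' \<and> j = j'" for i j i' j'
    using f by (auto simp: w_def inj_eq)
  define h where "h = w 0 0"
  define path where "path i = h # map (\<lambda>j. w i (Suc j)) [0..<m i]" for i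
  have set_path: "set (path i) = insert h (w i ` Suc ` {..<m i})" for i
    by (auto simp: path_def)
  have inj: "inj_on path {..<\<Delta>}"
  proof (rule inj_onI)
    fix i j assume *: "i \<in> {..<\<Delta>}" "j \<in> {..<\<Delta>}" "path i = path j"
    hence "path i ! 1 = path j ! 1" by simp
    moreover have "0 < m i" "0 < m j" using m[of i] m[of j] * by auto
    ultimately show "i = j" by (simp add: path_def w_eq)
  qed
  have "hub_paths (path ` {..<\<Delta>}) h"
  proof
    fix p assume "p \<in> path ` {..<\<Delta>}"
    then obtain i where i: "i < \<Delta>" "p = path i" by blast
    show "2 \<le> length p" using m i by (auto simp: path_def)
    show "hd p = h" using i by (simp add: path_def)
    show "distinct p" using i by (auto simp: path_def h_def w_eq distinct_map inj_on_def)
    fix q assume "q \<in> path ` {..<\<Delta>}" "p \<noteq> q"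
    thus "set p \<inter> set q = {h}" using i by (auto simp: set_path w_eq)
  qed simp
  moreover have "card (path ` {..<\<Delta>}) = \<Delta>" using inj by (simp add: card_image)
  moreover have "(\<Sum>p\<in>path ` {..<\<Delta>}. g (length p)) = (\<Sum>i<\<Delta>. g (Suc (m i)))"
    for g :: "nat \<Rightarrow> nat"
  proof -
    have "length (path i) = Suc (m i)" for i by (simp add: path_def)
    thus ?thesis using inj by (simp add: sum.reindex)
  qed
  ultimately show ?thesis using that by blast
qed

section \<open>The minimum\<close>

text \<open>
  The bound \<open>card_pverts_ge\<close> is sharp. The truncated subtraction expresses that no short path is needed
  once there are at least two vertices other than the hub for each path.
\<close>
lemma hub_paths_with_fewest_short:
  fixes \<Delta> n :: nat
  assumes "1 \<le> \<Delta>" "\<Delta> + 1 \<le> n"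
  obtains L and h :: "'a :: infinite" where "hub_paths L h" "card L = \<Delta>"
    "card (pverts (hub_paths.spider L h)) = n"
    "card {p \<in> L. length p = 2} = 2 * \<Delta> + 1 - n"
proof -
  define l where "l = 2 * \<Delta> + 1 - n"
  \<comment> \<open>The surplus assigned to path 0 vanishes whenever \<open>l > 0\<close>, so it never lengthens a short path.\<close>
  define m where "m i = (if i < l then 1 else 2) + (if i = 0 then n - 1 - (2 * \<Delta> - l) else 0)"
    for i :: nat
  have l: "l \<le> \<Delta>" using assms by (simp add: l_def)
  have short: "m i = 1 \<longleftrightarrow> i < l" for i using assms by (auto simp: m_def l_def)
  have pos: "1 \<le> m i" for i by (simp add: m_def)
  have below: "{i. i < \<Delta> \<and> i < l} = {..<l}" using l by auto
  have sum_base: "(\<Sum>i<\<Delta>. if i < l then 1 else 2) = 2 * \<Delta> - l"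
  proof -
    have "(\<Sum>i<\<Delta>. if i < l then 1 else 2) + l = (\<Sum>i<\<Delta>. (if i < l then 1 else 2) + (if i < l then 1 else 0))"
      using below by (simp add: sum.distrib sum.If_cases Int_def)
    also have "\<dots> = (\<Sum>i<\<Delta>. 2)" by (intro sum.cong) auto
    finally show ?thesis by simp
  qed
  have sum_m: "(\<Sum>i<\<Delta>. m i) = n - 1"
    using assms unfolding m_def sum.distrib sum_base by (simp add: l_def)
  obtain L and h :: 'a where L: "hub_paths L h" "card L = \<Delta>"
    and sum_L: "\<forall>g :: nat \<Rightarrow> nat. (\<Sum>p\<in>L. g (length p)) = (\<Sum>i<\<Delta>. g (Suc (m i)))"
    using hub_paths_with_lengths[of \<Delta> m] pos by blast
  interpret hub_paths L h by fact
  have "card (pverts spider) = n"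
    using sum_L[THEN spec, of "\<lambda>k. k - 1"] sum_m assms unfolding card_pverts by simp
  moreover have "card {p \<in> L. length p = 2} = l"
    using sum_L[THEN spec, of "\<lambda>k. if k = 2 then 1 else 0"] finite_paths short below
    by (simp add: sum.If_cases Int_def)
  ultimately show ?thesis using that L l_def by blast
qed

theorem theorem6p5:
  fixes \<Delta> n :: nat and l :: int
  assumes "\<Delta> \<ge> 3" and "n \<ge> \<Delta> + 1"
    and "l = max 0 (2 * int \<Delta> + 1 - int n)"
  shows "is_minimum
    (l * (int \<Delta> - 1)\<^sup>2 + (int \<Delta> - l) * ((int \<Delta> - 2)\<^sup>2 + 1))
    {sigma T | T :: 'a::infinite pair_pre_digraph.
       card (pverts T) = n \<and> (\<exists>h. single_hub_spider T h \<Delta>)}"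
proof -
  define cost where "cost k = k * (int \<Delta> - 1)\<^sup>2 + (int \<Delta> - k) * ((int \<Delta> - 2)\<^sup>2 + 1)" for k
  have cost_linear: "cost k = k * (2 * (int \<Delta> - 2)) + int \<Delta> * ((int \<Delta> - 2)\<^sup>2 + 1)" for k
    by (simp add: cost_def power2_eq_square algebra_simps)
  have cost_mono: "cost k \<le> cost k'" if "k \<le> k'" for k k'
    unfolding cost_linear using that assms(1) by (intro add_right_mono mult_right_mono) auto
  have "is_minimum (cost l) {sigma T | T :: 'a pair_pre_digraph.
       card (pverts T) = n \<and> (\<exists>h. single_hub_spider T h \<Delta>)}" (is "is_minimum _ ?A")
    unfolding is_minimum_def
  proof (intro conjI ballI)
    obtain L and h :: 'a where L: "hub_paths L h" "card L = \<Delta>"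
      "card (pverts (hub_paths.spider L h)) = n" "card {p \<in> L. length p = 2} = 2 * \<Delta> + 1 - n"
      using hub_paths_with_fewest_short[of \<Delta> n] assms by auto
    interpret hub_paths L h by fact
    have "sigma spider = cost l"
      using L(2,4) assms(3) by (auto simp: sigma_spider cost_def of_nat_diff max_def)
    thus "cost l \<in> ?A" using L single_hub_spider_spider by (auto intro!: exI[of _ spider])
  next
    fix x assume "x \<in> ?A"
    then obtain T :: "'a pair_pre_digraph" and h
      where T: "x = sigma T" "card (pverts T) = n" "single_hub_spider T h \<Delta>" by blast
    then obtain L where L: "hub_paths L h" "card L = \<Delta>" "T = hub_paths.spider L h"
      using single_hub_spider_eq_spider by metis
    interpret hub_paths L h by fact
    have "l \<le> int (card {p \<in> L. length p = 2})"
      using card_pverts_ge T L assms(3) by auto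
    thus "cost l \<le> x" using cost_mono L T by (simp add: sigma_spider cost_def)
  qed
  thus ?thesis by (simp add: cost_def)
qed

end
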